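(* Let $G$ be a connected undirected graph with $n$ nodes, $m$ edges and incidence matrix $B\in\mathbb R^{n\times m}$. Let $\boldsymbol\omega\in\mathbb R^n$ be given, let $f_{\mathcal E}:\mathbb R_+^m\to\mathbb R$ be convex, let $F_{\mathbf w}\subset\mathbb R_+^m$ be a closed convex set with $\lambda_2(L(\mathbf w))>0$ for all $\mathbf w\in F_{\mathbf w}$, let $\gamma_d\in[0,\pi/2)$ and let $\alpha>0$ (a regularization constant). Consider the weight design problem $$\underset{\mathbf w\in F_{\mathbf w}}{\text{minimize}}\ f_{\mathcal E}(\mathbf w)\quad\text{s.t.}\quad\|B^\top L(\mathbf w)^\dagger\boldsymbol\omega\|_\infty\le\sin(\gamma_d).$$ Then the problem $$\underset{\mathbf w\in F_{\mathbf w},\ \overline L\in\mathbb S^{n\times n}}{\text{minimize}}\ f_{\mathcal E}(\mathbf w)+\alpha\,\mathrm{Tr}(\overline L)\quad\text{s.t.}\quad\begin{bmatrix}L(\mathbf w)+\frac1n\mathbf 1_n\mathbf 1_n^\top& I_n\\ I_n&\overline L\end{bmatrix}\succeq0,\quad \|B^\top\overline L\boldsymbol\omega\|_\infty\le\sin(\gamma_d)$$ is a convex outer approximation of the weight design problem; that is, it is a convex optimization problem, and for every $\mathbf w$ feasible for the weight design problem there exists $\overline L\in\mathbb S^{n\times n}$ such that $(\mathbf w,\overline L)$ is feasible for it.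
   Context: The incidence matrix $B$ has, for each edge $e=\{i,j\}$, a column with entries $1$ and $-1$ at positions $i$ and $j$ (in either order) and zeros elsewhere. The weighted Laplacian is $L(\mathbf w)=B\,\mathrm{diag}(\mathbf w)B^\top$; $\lambda_2(L(\mathbf w))$ is its second smallest eigenvalue; $(\cdot)^\dagger$ is the Moore-Penrose pseudoinverse. $\mathbb S^{n\times n}$ is the set of real symmetric $n\times n$ matrices, $\succeq0$ means positive semidefinite, $\mathbf 1_n$ is the all-ones vector, and $\|\mathbf x\|_\infty=\max_i|x_i|$. The weight design problem is the special case $\Omega=\{\boldsymbol\omega\}$ of the robust problem of minimizing $f_{\mathcal E}(\mathbf w)$ over $\mathbf w\in F_{\mathbf w}$ subject to $\max_{\boldsymbol\omega\in\Omega}\|B^\top L(\mathbf w)^\dagger\boldsymbol\omega\|_\infty\le\sin(\gamma_d)$. "Outer approximation" refers to the feasible sets: the projection onto $\mathbf w$ of the feasible set of the approximating problem contains the feasible set of the original problem. *)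

theory Defs
  imports "HOL-Analysis.Analysis" "HOL-Computational_Algebra.Polynomial"
begin

section \<open>Graphs and incidence matrices\<close>

text \<open>A finite simple graph on the vertex set \<open>UNIV :: 'n set\<close> is given by its set of edges,
  which are two-element sets of vertices.\<close>

definition simple_graph :: "'n set set \<Rightarrow> bool" where
  "simple_graph E \<longleftrightarrow> (\<forall>e\<in>E. card e = 2)"

definition connected_graph :: "'n set set \<Rightarrow> bool" where
  "connected_graph E \<longleftrightarrow> (\<forall>u v. (u, v) \<in> {(i, j). {i, j} \<in> E}\<^sup>*)"

text \<open>The columns of \<open>B\<close> are indexed by a type \<open>'m\<close> in bijection with the edges (so \<open>CARD('m)\<close> is
  the number of edges). Both the enumeration of the edges and the sign choice in each column are
  arbitrary.\<close>

definition incidence_matrix :: "'n::finite set set \<Rightarrow> real^'m^'n \<Rightarrow> bool" where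
  "incidence_matrix E B \<longleftrightarrow>
     (\<exists>edge. bij_betw edge UNIV E \<and>
        (\<forall>e. \<exists>i j. i \<noteq> j \<and> edge e = {i, j} \<and> B $ i $ e = 1 \<and> B $ j $ e = - 1 \<and>
              (\<forall>k. k \<notin> {i, j} \<longrightarrow> B $ k $ e = 0)))"

section \<open>Matrices\<close>

definition diag_matrix :: "real^'m \<Rightarrow> real^'m^'m" where
  "diag_matrix w = (\<chi> i j. if i = j then w $ i else 0)"

definition laplacian :: "real^'m^'n \<Rightarrow> real^'m \<Rightarrow> real^'n^'n" where
  "laplacian B w = B ** diag_matrix w ** transpose B"

definition charpoly :: "real^'n^'n \<Rightarrow> real poly" where
  "charpoly A = det (\<chi> i j. (if i = j then [:0, 1:] else 0) - [:A $ i $ j:])"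

text \<open>The second smallest eigenvalue, counted with multiplicity. It is meaningful for symmetric
  matrices of size at least 2, whose characteristic polynomial splits over the reals; the list
  index \<open>1\<close> denotes the second entry.\<close>

definition lambda2 :: "real^'n^'n \<Rightarrow> real" where
  "lambda2 A = sorted_list_of_multiset (proots (charpoly A)) ! 1"

definition is_pseudoinverse :: "real^'n^'m \<Rightarrow> real^'m^'n \<Rightarrow> bool" where
  "is_pseudoinverse A X \<longleftrightarrow>
     A ** X ** A = A \<and> X ** A ** X = X \<and>
     transpose (A ** X) = A ** X \<and> transpose (X ** A) = X ** A"

definition pseudoinverse :: "real^'n^'m \<Rightarrow> real^'m^'n" where
  "pseudoinverse A = (THE X. is_pseudoinverse A X)"

definition symmetric_matrices :: "(real^'n^'n) set" where
  "symmetric_matrices = {A. transpose A = A}"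

definition psd :: "real^'n^'n \<Rightarrow> bool" where
  "psd A \<longleftrightarrow> A \<in> symmetric_matrices \<and> (\<forall>x. 0 \<le> x \<bullet> (A *v x))"

definition block_matrix ::
  "real^'n^'n \<Rightarrow> real^'m^'n \<Rightarrow> real^'n^'m \<Rightarrow> real^'m^'m \<Rightarrow> real^('n + 'm)^('n + 'm)" where
  "block_matrix A B C D = (\<chi> p q.
     case p of
       Inl i \<Rightarrow> (case q of Inl j \<Rightarrow> A $ i $ j | Inr j \<Rightarrow> B $ i $ j)
     | Inr i \<Rightarrow> (case q of Inl j \<Rightarrow> C $ i $ j | Inr j \<Rightarrow> D $ i $ j))"

definition averaging_matrix :: "real^'n^'n" where
  "averaging_matrix = (\<chi> i j. 1 / real CARD('n))"

definition nonneg_orthant :: "(real^'m) set" where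
  "nonneg_orthant = {w. \<forall>e. 0 \<le> w $ e}"

section \<open>Optimization problems\<close>

text \<open>Minimize the objective over the points of the ground set that satisfy the constraint.\<close>

datatype 'a opt_problem =
  Minimize (objective: "'a \<Rightarrow> real") (ground: "'a set") (constraint: "'a \<Rightarrow> bool")

definition feasible :: "'a opt_problem \<Rightarrow> 'a set" where
  "feasible P = {x \<in> ground P. constraint P x}"

text \<open>The objective has to be convex on the whole ground set, not only on the (possibly empty)
  feasible set; \<open>convex_on\<close> includes convexity of the ground set.\<close>

definition convex_problem :: "'a::real_vector opt_problem \<Rightarrow> bool" where
  "convex_problem P \<longleftrightarrow> convex_on (ground P) (objective P) \<and> convex (feasible P)"

text \<open>Outer approximation refers to feasible sets only: \<open>Q\<close> has an additional variable, and the
  projection of its feasible set contains that of \<open>P\<close>.\<close>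

definition outer_approximation :: "('a \<times> 'b) opt_problem \<Rightarrow> 'a opt_problem \<Rightarrow> bool" where
  "outer_approximation Q P \<longleftrightarrow> feasible P \<subseteq> fst ` feasible Q"

text \<open>The norm \<open>infnorm\<close> is the maximum norm; compare \<open>infnorm_cart\<close>.\<close>

definition weight_design_problem ::
  "real^'m^'n \<Rightarrow> real^'n \<Rightarrow> (real^'m \<Rightarrow> real) \<Rightarrow> (real^'m) set \<Rightarrow> real \<Rightarrow> (real^'m) opt_problem" where
  "weight_design_problem B \<omega> f F \<gamma> =
     Minimize f F
       (\<lambda>w. infnorm (transpose B *v (pseudoinverse (laplacian B w) *v \<omega>)) \<le> sin \<gamma>)"

definition relaxed_problem ::
  "real^'m^'n \<Rightarrow> real^'n \<Rightarrow> (real^'m \<Rightarrow> real) \<Rightarrow> (real^'m) set \<Rightarrow> real \<Rightarrow> real \<Rightarrow>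
   ((real^'m) \<times> (real^'n^'n)) opt_problem" where
  "relaxed_problem B \<omega> f F \<gamma> \<alpha> =
     Minimize (\<lambda>(w, Lbar). f w + \<alpha> * trace Lbar) (F \<times> symmetric_matrices)
       (\<lambda>(w, Lbar). psd (block_matrix (laplacian B w + averaging_matrix) (mat 1) (mat 1) Lbar) \<and>
                    infnorm (transpose B *v (Lbar *v \<omega>)) \<le> sin \<gamma>)"

end

theory Submission
  imports Defs
begin

text \<open>Let \<open>J\<close> be the averaging matrix. If \<open>\<lambda>\<^sub>2(L) > 0\<close>, then the kernel of \<open>L\<close> is spanned by the
  all-ones vector, so \<open>L + J\<close> is positive definite, with inverse \<open>L\<^sup>\<dagger> + J\<close>. Taking
  this inverse for \<open>Lbar\<close> satisfies the matrix inequality, and since \<open>B\<^sup>T J = 0\<close> it gives the same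
  value of the norm constraint as \<open>L\<^sup>\<dagger>\<close>. Convexity holds because the constraints depend affinely
  on \<open>(w, Lbar)\<close>.\<close>

section \<open>Matrices\<close>

lemma matrix_add_rdistrib: "(A + B) ** C = A ** C + B ** C"
  by (simp add: matrix_matrix_mult_def vec_eq_iff sum.distrib distrib_right)

lemma matrix_diff_ldistrib: "A ** (B - C) = A ** B - A ** C" for A :: "'a::ring_1^'m^'n"
  by (simp add: matrix_matrix_mult_def vec_eq_iff sum_subtractf right_diff_distrib)

lemma matrix_diff_rdistrib: "(A - B) ** C = A ** C - B ** C" for C :: "'a::ring_1^'k^'m"
  by (simp add: matrix_matrix_mult_def vec_eq_iff sum_subtractf left_diff_distrib)

lemma symmetric_matrices_add:
  "A \<in> symmetric_matrices \<Longrightarrow> C \<in> symmetric_matrices \<Longrightarrow> A + C \<in> symmetric_matrices"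
  by (auto simp: symmetric_matrices_def transpose_def vec_eq_iff)

lemma symmetric_matrices_scaleR:
  "A \<in> symmetric_matrices \<Longrightarrow> c *\<^sub>R A \<in> symmetric_matrices"
  by (auto simp: symmetric_matrices_def transpose_def vec_eq_iff)

lemma convex_symmetric_matrices: "convex symmetric_matrices"
  by (auto simp: convex_def intro!: symmetric_matrices_add symmetric_matrices_scaleR)

lemma symmetric_matrices_self_adjoint:
  "A \<in> symmetric_matrices \<Longrightarrow> x \<bullet> (A *v y) = (A *v x) \<bullet> y"
  by (metis (mono_tags) dot_lmul_matrix mem_Collect_eq symmetric_matrices_def transpose_matrix_vector)

section \<open>Uniqueness of the Moore-Penrose pseudoinverse\<close>

text \<open>The Penrose equations make \<open>A ** X\<close> and \<open>A ** Y\<close> the same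
  orthogonal projection, onto the range of \<open>A\<close>; likewise \<open>X ** A\<close> and
  \<open>Y ** A\<close> coincide. Both equalities come from absorbing one product into the other and
  then transposing.\<close>

lemma is_pseudoinverse_unique:
  assumes "is_pseudoinverse A X" "is_pseudoinverse A Y"
  shows "X = Y"
proof -
  have X: "A ** X ** A = A" "X ** A ** X = X" "transpose (A ** X) = A ** X" "transpose (X ** A) = X ** A"
    and Y: "A ** Y ** A = A" "Y ** A ** Y = Y" "transpose (A ** Y) = A ** Y" "transpose (Y ** A) = Y ** A"
    using assms by (auto simp: is_pseudoinverse_def)
  have "A ** X = (A ** Y) ** (A ** X)"
    by (metis Y(1) matrix_mul_assoc)
  also have "\<dots> = transpose ((A ** X) ** (A ** Y))"
    by (metis X(3) Y(3) matrix_transpose_mul)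
  also have "\<dots> = A ** Y"
    by (metis X(1) Y(3) matrix_mul_assoc)
  finally have AX: "A ** X = A ** Y" .
  have "X ** A = (X ** A) ** (Y ** A)"
    by (metis Y(1) matrix_mul_assoc)
  also have "\<dots> = transpose ((Y ** A) ** (X ** A))"
    by (metis X(4) Y(4) matrix_transpose_mul)
  also have "\<dots> = Y ** A"
    by (metis X(1) Y(4) matrix_mul_assoc)
  finally have XA: "X ** A = Y ** A" .
  \<comment> \<open>The chain is \<open>X = X A X = X A Y = Y A Y = Y\<close>.\<close>
  show ?thesis
    by (metis AX XA X(2) Y(2) matrix_mul_assoc)
qed

lemma pseudoinverse_eq: "is_pseudoinverse A X \<Longrightarrow> pseudoinverse A = X"
  unfolding pseudoinverse_def by (blast intro: the_equality is_pseudoinverse_unique)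

section \<open>The averaging matrix\<close>

lemma averaging_matrix_vector:
  "(averaging_matrix :: real^'n^'n) *v x = (\<chi> i. (\<Sum>j\<in>UNIV. x $ j) / real CARD('n))"
  by (simp add: averaging_matrix_def matrix_vector_mult_def vec_eq_iff sum_divide_distrib)

lemma averaging_matrix_symmetric: "averaging_matrix \<in> symmetric_matrices"
  by (simp add: averaging_matrix_def symmetric_matrices_def transpose_def vec_eq_iff)

lemma averaging_matrix_idem: "averaging_matrix ** averaging_matrix = averaging_matrix"
  by (simp add: averaging_matrix_def matrix_matrix_mult_def vec_eq_iff)

section \<open>Block matrices with identity off-diagonal blocks\<close>

lemma block_matrix_symmetric_iff:
  "block_matrix A (mat 1) (mat 1) D \<in> symmetric_matrices \<longleftrightarrow>
     A \<in> symmetric_matrices \<and> D \<in> symmetric_matrices"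
  for A D :: "real^'n^'n"
  by (auto simp: block_matrix_def symmetric_matrices_def transpose_def vec_eq_iff mat_def
      split_sum_all)

lemma block_matrix_quadratic_form:
  fixes A D :: "real^'n^'n" and z :: "real^('n + 'n)"
  defines "x \<equiv> \<chi> i. z $ Inl i" and "y \<equiv> \<chi> i. z $ Inr i"
  shows "z \<bullet> (block_matrix A (mat 1) (mat 1) D *v z) = x \<bullet> (A *v x) + 2 * (x \<bullet> y) + y \<bullet> (D *v y)"
proof -
  have split: "(\<Sum>p\<in>UNIV. g p) = (\<Sum>i\<in>UNIV. g (Inl i)) + (\<Sum>i\<in>UNIV. g (Inr i))" for g :: "'n + 'n \<Rightarrow> real"
    using sum.Plus[of UNIV UNIV g] by simp
  have unit: "(\<Sum>j\<in>UNIV. mat 1 $ i $ j * v j) = v i" for i :: 'n and v :: "'n \<Rightarrow> real"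
    by (simp add: mat_def if_distrib[where f="\<lambda>a. a * _"] cong: if_cong)
  show ?thesis
    by (simp add: inner_vec_def matrix_vector_mult_def split block_matrix_def x_def y_def unit
        distrib_left sum.distrib mult.commute[of "z $ Inr _" "z $ Inl _"])
qed

text \<open>Splitting a stacked vector into its halves turns the matrix inequality into a family of
  scalar inequalities, each affine in \<open>(A, D)\<close>. This form serves both the choice of
  \<open>Lbar\<close> and the convexity proof.\<close>

lemma psd_block_matrix_iff:
  fixes A D :: "real^'n^'n"
  shows "psd (block_matrix A (mat 1) (mat 1) D) \<longleftrightarrow>
    A \<in> symmetric_matrices \<and> D \<in> symmetric_matrices \<and>
    (\<forall>x y. 0 \<le> x \<bullet> (A *v x) + 2 * (x \<bullet> y) + y \<bullet> (D *v y))"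
proof -
  have "(\<forall>z. 0 \<le> z \<bullet> (block_matrix A (mat 1) (mat 1) D *v z)) \<longleftrightarrow>
    (\<forall>x y. 0 \<le> x \<bullet> (A *v x) + 2 * (x \<bullet> y) + y \<bullet> (D *v y))"
  proof safe
    fix x y :: "real^'n"
    assume *: "\<forall>z. 0 \<le> z \<bullet> (block_matrix A (mat 1) (mat 1) D *v z)"
    show "0 \<le> x \<bullet> (A *v x) + 2 * (x \<bullet> y) + y \<bullet> (D *v y)"
      using *[rule_format, of "\<chi> p. case p of Inl i \<Rightarrow> x $ i | Inr i \<Rightarrow> y $ i"]
      by (simp add: block_matrix_quadratic_form)
  qed (simp add: block_matrix_quadratic_form)
  then show ?thesis
    by (auto simp: psd_def block_matrix_symmetric_iff)
qed

text \<open>The form is \<open>(x + N y) \<bullet> M (x + N y)\<close>: a Schur complement that vanishes.\<close>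

lemma psd_block_matrix_inverse:
  fixes M N :: "real^'n^'n"
  assumes "psd M" "N \<in> symmetric_matrices" "M ** N = mat 1"
  shows "psd (block_matrix M (mat 1) (mat 1) N)"
proof -
  have M: "M \<in> symmetric_matrices"
    using assms by (simp add: psd_def)
  have "0 \<le> x \<bullet> (M *v x) + 2 * (x \<bullet> y) + y \<bullet> (N *v y)" for x y
  proof -
    have MN: "M *v (N *v y) = y"
      using assms by (simp add: matrix_vector_mul_assoc)
    have "(N *v y) \<bullet> (M *v x) = y \<bullet> x"
      using symmetric_matrices_self_adjoint[OF M] MN by simp
    moreover have "0 \<le> (x + N *v y) \<bullet> (M *v (x + N *v y))"
      using assms by (simp add: psd_def)
    ultimately show ?thesis
      by (simp add: matrix_vector_right_distrib MN algebra_simps inner_commute)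
  qed
  with M assms show ?thesis
    by (simp add: psd_block_matrix_iff)
qed

section \<open>The characteristic polynomial\<close>

text \<open>Evaluation at \<open>t\<close> is a ring homomorphism, so it passes through the Leibniz
  formula.\<close>

lemma poly_charpoly: "poly (charpoly A) t = det (t *\<^sub>R mat 1 - A)"
  by (simp add: charpoly_def det_def poly_sum poly_prod mat_def of_int_poly)
    (intro sum.cong arg_cong2[where f="(*)"] prod.cong; simp)

lemma det_eq_0_imp_kernel:
  fixes A :: "real^'n^'n"
  assumes "det A = 0"
  obtains x where "A *v x = 0" "x \<noteq> 0"
  using assms by (metis invertible_det_nz invertible_left_inverse matrix_left_invertible_ker)

text \<open>A positive semidefinite matrix does not have the eigenvalue -1, so the polynomial does
  not vanish there. Nonvanishing is what allows multiplicities in \<open>proots\<close> to be read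
  as orders of roots.\<close>

lemma charpoly_nonzero:
  assumes "psd A"
  shows "charpoly A \<noteq> 0"
proof
  assume "charpoly A = 0"
  then have "det ((-1) *\<^sub>R mat 1 - A) = 0"
    using poly_charpoly[of A "-1"] by simp
  then obtain x where "((-1) *\<^sub>R mat 1 - A) *v x = 0" and "x \<noteq> 0"
    by (rule det_eq_0_imp_kernel)
  then have "A *v x = - x"
    by (metis eq_iff_diff_eq_0 matrix_vector_mul_lid matrix_vector_mult_diff_rdistrib
        scaleR_matrix_vector_assoc scaleR_minus1_left)
  then show False
    using assms \<open>x \<noteq> 0\<close> unfolding psd_def
    by (metis inner_gt_zero_iff inner_minus_right neg_0_le_iff_le not_le)
qed

text \<open>Embedding scalars as constant polynomials is a ring homomorphism. This lets the
  determinant of a real row transformation be pulled out of a polynomial determinant.\<close>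

lemma det_map_const_poly:
  "det (\<chi> i j. [:A $ i $ j:]) = [:det A:]" for A :: "'a::comm_ring_1^'n^'n"
proof -
  have prod: "(\<Prod>i\<in>S. [:g i:]) = [:prod g S:]" for g :: "'n \<Rightarrow> 'a" and S
    by (induction S rule: infinite_finite_induct) (auto simp: one_pCons)
  show ?thesis
    by (simp add: det_def of_int_poly prod sum_to_poly mult.commute)
qed

text \<open>Multiplying \<open>x I - A\<close> from the left by an invertible matrix that has \<open>u\<close> and \<open>v\<close> among its
  rows produces two rows divisible by \<open>x\<close>.\<close>

lemma charpoly_dvd_square:
  fixes A :: "real^'n^'n"
  assumes sym: "A \<in> symmetric_matrices" and u: "A *v u = 0" and v: "A *v v = 0"
    and ij: "i \<noteq> j" "u $ i \<noteq> 0" "v $ i = 0" "v $ j \<noteq> 0"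
  shows "[:0, 1:]\<^sup>2 dvd charpoly A"
proof -
  define P :: "real^'n^'n" where "P = (\<chi> k. if k = i then u else if k = j then v else axis k 1)"
  define X :: "real poly^'n^'n" where "X = (\<chi> i j. (if i = j then [:0, 1:] else 0) - [:A $ i $ j:])"
  define C where "C = (\<chi> i j. [:P $ i $ j:])"
  have "det P \<noteq> 0"
  proof
    assume "det P = 0"
    then have "det (transpose P) = 0" by simp
    then obtain x where x: "transpose P *v x = 0" "x \<noteq> 0"
      by (rule det_eq_0_imp_kernel)
    have P: "(\<Sum>k\<in>UNIV. P $ k $ l * x $ k) = 0" for l
      using x(1) by (simp add: matrix_vector_mult_def transpose_def vec_eq_iff)
    \<comment> \<open>Rows other than \<open>i\<close> and \<open>j\<close> are unit vectors, so
      they contribute \<open>x $ l\<close> exactly when \<open>l\<close> differs from both.\<close>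
    have split: "(\<Sum>k\<in>UNIV. P $ k $ l * x $ k) = 
        u $ l * x $ i + v $ l * x $ j + (if l = i \<or> l = j then 0 else x $ l)" for l
    proof -
      have "(\<Sum>k\<in>UNIV. P $ k $ l * x $ k) = (\<Sum>k\<in>UNIV. (if k = i then u $ l * x $ k else 0) + 
         (if k = j then v $ l * x $ k else 0) + (if k = l then if l = i \<or> l = j then 0 else x $ l else 0))"
        using ij(1) by (intro sum.cong) (auto simp: P_def axis_def)
      then show ?thesis by (simp add: sum.distrib)
    qed
    \<comment> \<open>Triangular elimination: at \<open>l = i\<close> the term with \<open>v\<close>
      drops out because \<open>v $ i = 0\<close>; at \<open>l = j\<close> only
      \<open>v $ j * x $ j\<close> is then left; the remaining equations read
      \<open>x $ l = 0\<close>.\<close>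
    have "x $ i = 0" using split[of i] P[of i] ij by simp
    moreover from this have "x $ j = 0" using split[of j] P[of j] ij by simp
    ultimately have "x $ l = 0" for l using split[of l] P[of l] by (cases "l = i \<or> l = j") auto
    then have "x = 0" by (simp add: vec_eq_iff)
    with x show False by simp
  qed
  \<comment> \<open>By symmetry a kernel vector \<open>y\<close> also satisfies
    \<open>y v* A = 0\<close>. So multiplying the row \<open>y\<close> by \<open>X\<close> leaves
    only the indeterminate times \<open>y\<close>.\<close>
  have row: "[:0, 1:] dvd (C ** X) $ k $ l" if "A *v y = 0" and "P $ k = y" for k l y
  proof -
    have "(\<Sum>m\<in>UNIV. y $ m * A $ m $ l) = (y v* A) $ l"
      by (simp add: vector_matrix_mult_def mult.commute)
    also have "y v* A = 0"
      using that(1) sym transpose_matrix_vector[of A y] by (simp add: symmetric_matrices_def del: transpose_matrix_vector)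
    finally have "(\<Sum>m\<in>UNIV. [:y $ m * A $ m $ l:]) = 0"
      by (simp add: sum_to_poly)
    moreover have "(C ** X) $ k $ l = (\<Sum>m\<in>UNIV. if m = l then [:y $ m:] * [:0, 1:] else 0)
        - (\<Sum>m\<in>UNIV. [:y $ m * A $ m $ l:])"
      unfolding matrix_matrix_mult_def C_def X_def that(2)[symmetric] sum_subtractf[symmetric]
      by (simp, intro sum.cong) (simp_all add: right_diff_distrib)
    ultimately have "(C ** X) $ k $ l = [:y $ l:] * [:0, 1:]"
      by simp
    then show ?thesis
      by (metis dvd_triv_right)
  qed
  \<comment> \<open>Every product in the Leibniz formula takes one entry from row \<open>i\<close>
    and one from row \<open>j\<close>.\<close>
  have "[:0, 1:]\<^sup>2 dvd det (C ** X)"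
    unfolding det_def
  proof (intro dvd_sum dvd_mult)
    fix p :: "'n \<Rightarrow> 'n"
    have "[:0, 1:] dvd (C ** X) $ i $ p i" "[:0, 1:] dvd (C ** X) $ j $ p j"
      using row[OF u, of i] row[OF v, of j] ij(1) by (simp_all add: P_def)
    then have "[:0, 1:] * [:0, 1:] dvd (C ** X) $ i $ p i * (C ** X) $ j $ p j"
      by (rule mult_dvd_mono)
    also have "\<dots> = (\<Prod>k\<in>{i, j}. (C ** X) $ k $ p k)"
      using ij(1) by simp
    also have "\<dots> dvd (\<Prod>k\<in>UNIV. (C ** X) $ k $ p k)"
      by (rule prod_dvd_prod_subset) simp_all
    finally show "[:0, 1:]\<^sup>2 dvd (\<Prod>k\<in>UNIV. (C ** X) $ k $ p k)"
      unfolding power2_eq_square .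
  qed
  also have "det (C ** X) = smult (det P) (charpoly A)"
    by (simp add: det_mul C_def det_map_const_poly X_def charpoly_def)
  finally show ?thesis
    using \<open>det P \<noteq> 0\<close> by (simp add: dvd_smult_iff)
qed

section \<open>The second smallest root\<close>

text \<open>Dropping the head removes at most one copy of \<open>a\<close>, so \<open>a\<close>
  still occurs in the tail, whose least entry is \<open>xs ! 1\<close>.\<close>

lemma sorted_second_le:
  fixes xs :: "'a::linorder list"
  assumes "sorted xs" "2 \<le> count (mset xs) a"
  shows "xs ! 1 \<le> a"
proof (rule ccontr)
  assume "\<not> xs ! 1 \<le> a"
  obtain x ys where xs: "xs = x # ys"
    using assms(2) by (cases xs) auto
  have "a \<in> set ys"
  proof (rule ccontr)
    assume "a \<notin> set ys"
    then have count: "count (mset ys) a = 0" by simp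
    show False
      using assms(2) by (simp add: xs count split: if_splits)
  qed
  then obtain k where "k < length ys" "ys ! k = a"
    by (auto simp: in_set_conv_nth)
  then have "ys ! 0 \<le> a"
    using assms(1) xs sorted_nth_mono[of ys 0 k] by simp
  with \<open>\<not> xs ! 1 \<le> a\<close> xs show False by simp
qed

text \<open>Zero is a root of order at least two, hence appears at least twice in the sorted
  list.\<close>

lemma lambda2_nonpos:
  assumes "[:0, 1:]\<^sup>2 dvd charpoly A" "charpoly A \<noteq> 0"
  shows "lambda2 A \<le> 0"
proof -
  have "2 \<le> order 0 (charpoly A)"
    using assms order_divides[of 0 2 "charpoly A"] by simp
  then show ?thesis
    unfolding lambda2_def using assms(2)
    by (intro sorted_second_le) simp_all
qed

section \<open>The weighted Laplacian\<close>

lemma laplacian_vector: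
  "laplacian B w *v x = B *v (\<chi> e. w $ e * (transpose B *v x) $ e)"
proof -
  have "diag_matrix w *v y = (\<chi> e. w $ e * y $ e)" for y
    by (simp add: diag_matrix_def matrix_vector_mult_def vec_eq_iff
        if_distrib[where f="\<lambda>a. a * _"] cong: if_cong)
  then show ?thesis
    by (simp add: laplacian_def flip: matrix_vector_mul_assoc)
qed

lemma laplacian_add: "laplacian B (w + w') = laplacian B w + laplacian B w'"
proof -
  have "diag_matrix (w + w') = diag_matrix w + diag_matrix w'"
    by (simp add: diag_matrix_def vec_eq_iff)
  then show ?thesis
    by (simp add: laplacian_def matrix_add_ldistrib matrix_add_rdistrib)
qed

lemma laplacian_scaleR: "laplacian B (c *\<^sub>R w) = c *\<^sub>R laplacian B w"
proof -
  have "diag_matrix (c *\<^sub>R w) = c *\<^sub>R diag_matrix w"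
    by (simp add: diag_matrix_def vec_eq_iff)
  then show ?thesis
    by (simp add: laplacian_def matrix_scalar_ac flip: scalar_matrix_assoc)
qed

lemma laplacian_symmetric: "laplacian B w \<in> symmetric_matrices"
proof -
  have "transpose (diag_matrix w) = diag_matrix w"
    by (auto simp: diag_matrix_def transpose_def vec_eq_iff)
  then show ?thesis
    by (simp add: laplacian_def symmetric_matrices_def matrix_transpose_mul matrix_mul_assoc)
qed

lemma laplacian_quadratic_form:
  "x \<bullet> (laplacian B w *v x) = (\<Sum>e\<in>UNIV. w $ e * ((transpose B *v x) $ e)\<^sup>2)"
proof -
  have "x \<bullet> (B *v y) = (transpose B *v x) \<bullet> y" for y
    using dot_lmul_matrix[of x B y] by simp
  then show ?thesis
    by (simp add: laplacian_vector inner_vec_def power2_eq_square algebra_simps)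
qed

lemma psd_laplacian: "w \<in> nonneg_orthant \<Longrightarrow> psd (laplacian B w)"
  by (auto simp: psd_def laplacian_symmetric laplacian_quadratic_form nonneg_orthant_def
      intro!: sum_nonneg)

text \<open>A vanishing sum of nonnegative terms vanishes termwise. Some weights may be zero, so
  only the products of \<open>w $ e\<close> with the entries of \<open>transpose B *v x\<close> are
  known to vanish; these form the vector to which \<open>B\<close> is applied.\<close>

lemma laplacian_isotropic_imp_kernel:
  assumes "w \<in> nonneg_orthant" "x \<bullet> (laplacian B w *v x) = 0"
  shows "laplacian B w *v x = 0"
proof -
  have "w $ e * ((transpose B *v x) $ e)\<^sup>2 = 0" for e
    using assms by (subst (asm) laplacian_quadratic_form, subst (asm) sum_nonneg_eq_0_iff)
      (auto simp: nonneg_orthant_def)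
  then have "(\<chi> e. w $ e * (transpose B *v x) $ e) = 0"
    by (simp add: vec_eq_iff)
  then show ?thesis
    by (simp add: laplacian_vector)
qed

lemma incidence_matrix_transpose_const:
  assumes "incidence_matrix E B"
  shows "transpose B *v (\<chi> i. c) = 0"
proof -
  have "(\<Sum>k\<in>UNIV. B $ k $ e * c) = 0" for e
  proof -
    obtain i j where ij: "i \<noteq> j" "B $ i $ e = 1" "B $ j $ e = -1" "\<And>k. k \<notin> {i, j} \<Longrightarrow> B $ k $ e = 0"
      using assms unfolding incidence_matrix_def by metis
    have "(\<Sum>k\<in>UNIV. B $ k $ e * c) = (\<Sum>k\<in>{i, j}. B $ k $ e * c)"
      by (rule sum.mono_neutral_right) (use ij(4) in auto)
    with ij show ?thesis by simp
  qed
  then show ?thesis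
    by (simp add: matrix_vector_mult_def transpose_def vec_eq_iff)
qed

section \<open>The shifted Laplacian and its inverse at one weight vector\<close>

locale weighted_laplacian =
  fixes E :: "'n::finite set set" and B :: "real^'m^'n" and w :: "real^'m"
  assumes incidence: "incidence_matrix E B"
    and nonneg: "w \<in> nonneg_orthant"
    and lambda2_pos: "0 < lambda2 (laplacian B w)"
begin

lemma laplacian_const: "laplacian B w *v (\<chi> i. c) = 0"
  unfolding laplacian_vector incidence_matrix_transpose_const[OF incidence]
  by (simp add: vec_eq_iff matrix_vector_mult_def)

text \<open>A nonconstant kernel vector would be independent of the all-ones vector, making zero a
  double root and contradicting \<open>lambda2_pos\<close>.\<close>

lemma laplacian_kernel_const:
  assumes "laplacian B w *v x = 0"
  shows "x $ i = x $ j"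
proof (rule ccontr)
  assume neq: "x $ i \<noteq> x $ j"
  have "[:0, 1:]\<^sup>2 dvd charpoly (laplacian B w)"
  \<comment> \<open>Subtracting the constant \<open>x $ i\<close> stays in the kernel and yields the
    required pattern: \<open>v\<close> vanishes at \<open>i\<close> but not at
    \<open>j\<close>.\<close>
  proof (rule charpoly_dvd_square[where u = "\<chi> i. 1" and v = "x - (\<chi> k. x $ i)"])
    show "laplacian B w *v (x - (\<chi> k. x $ i)) = 0"
      by (simp add: matrix_vector_mult_diff_distrib assms laplacian_const)
  qed (use neq in \<open>auto simp: laplacian_symmetric laplacian_const\<close>)
  then show False
    using lambda2_nonpos charpoly_nonzero[OF psd_laplacian[OF nonneg]] lambda2_pos by fastforce
qed

definition shifted :: "real^'n^'n" where
  "shifted = laplacian B w + averaging_matrix"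

lemma shifted_quadratic_form:
  "x \<bullet> (shifted *v x) = x \<bullet> (laplacian B w *v x) + (\<Sum>i\<in>UNIV. x $ i)\<^sup>2 / real CARD('n)"
  by (simp add: shifted_def matrix_vector_mult_add_rdistrib inner_add_right averaging_matrix_vector)
    (simp add: inner_vec_def power2_eq_square flip: sum_distrib_right sum_divide_distrib)

lemma psd_shifted: "psd shifted"
  unfolding psd_def
proof safe
  show "shifted \<in> symmetric_matrices"
    by (simp add: shifted_def symmetric_matrices_add laplacian_symmetric averaging_matrix_symmetric)
  show "0 \<le> x \<bullet> (shifted *v x)" for x
    using psd_laplacian[OF nonneg, of B] by (simp add: shifted_quadratic_form psd_def)
qed

text \<open>For a kernel vector both nonnegative parts of the quadratic form vanish: the Laplacian
  part makes it constant, and the averaging part makes its entries sum to zero.\<close>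

lemma invertible_shifted: "invertible shifted"
proof -
  have "x = 0" if "shifted *v x = 0" for x
  proof -
    have nn: "0 \<le> x \<bullet> (laplacian B w *v x)"
      using psd_laplacian[OF nonneg, of B] by (simp add: psd_def)
    have "x \<bullet> (laplacian B w *v x) + (\<Sum>i\<in>UNIV. x $ i)\<^sup>2 / real CARD('n) = 0"
      using that by (simp flip: shifted_quadratic_form)
    with nn have "x \<bullet> (laplacian B w *v x) = 0" and sum: "(\<Sum>i\<in>UNIV. x $ i) = 0"
      by (auto simp: add_nonneg_eq_0_iff)
    then have const: "x $ i = x $ j" for i j
      using laplacian_isotropic_imp_kernel[OF nonneg] laplacian_kernel_const by blast
    have "x $ i = 0" for i
    proof -
      have "(\<Sum>j\<in>UNIV. x $ j) = (\<Sum>j\<in>(UNIV::'n set). x $ i)"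
        using const by (intro sum.cong) auto
      with sum show ?thesis by simp
    qed
    then show ?thesis by (simp add: vec_eq_iff)
  qed
  then show ?thesis
    by (simp add: invertible_left_inverse matrix_left_invertible_ker)
qed

lemma shifted_inverse: "\<exists>N \<in> symmetric_matrices. shifted ** N = mat 1 \<and> N ** shifted = mat 1"
proof -
  obtain N where N: "shifted ** N = mat 1" "N ** shifted = mat 1"
    using invertible_shifted by (auto simp: invertible_def)
  have "transpose shifted = shifted"
    using psd_shifted by (simp add: psd_def symmetric_matrices_def)
  with N have "transpose N ** shifted = mat 1"
    by (metis matrix_transpose_mul transpose_mat)
  then have "transpose N = N"
    by (metis N(1) matrix_mul_assoc matrix_mul_lid matrix_mul_rid)
  with N show ?thesis
    by (auto simp: symmetric_matrices_def)
qed

lemma laplacian_averaging: "laplacian B w ** averaging_matrix = 0"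
proof -
  have "(laplacian B w ** averaging_matrix) *v x = 0 *v x" for x
    by (simp add: averaging_matrix_vector laplacian_const flip: matrix_vector_mul_assoc)
  then show ?thesis
    by (simp add: matrix_eq)
qed

text \<open>Since \<open>shifted\<close> fixes the averaging matrix, so does \<open>N\<close>. Both
  products of the Laplacian with the candidate then equal the identity minus the averaging matrix,
  the orthogonal projection onto the vectors of sum zero, and the Penrose equations follow.\<close>

lemma pseudoinverse_laplacian:
  assumes N: "N \<in> symmetric_matrices" "shifted ** N = mat 1" "N ** shifted = mat 1"
  shows "pseudoinverse (laplacian B w) = N - averaging_matrix"
proof (rule pseudoinverse_eq)
  let ?L = "laplacian B w" and ?J = "averaging_matrix :: real^'n^'n"
  have J: "transpose ?J = ?J" and L: "transpose ?L = ?L" and NT: "transpose N = N"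
    using averaging_matrix_symmetric laplacian_symmetric N by (auto simp: symmetric_matrices_def)
  have JL: "?J ** ?L = 0"
  proof -
    have "transpose (?L ** ?J) = 0"
      unfolding laplacian_averaging by (simp add: transpose_def vec_eq_iff)
    then show ?thesis by (simp add: matrix_transpose_mul J L)
  qed
  have "shifted ** ?J = ?J"
    by (simp add: shifted_def matrix_add_rdistrib laplacian_averaging averaging_matrix_idem)
  then have NJ: "N ** ?J = ?J"
    by (metis N(3) matrix_mul_assoc matrix_mul_lid)
  then have JN: "?J ** N = ?J"
    by (metis J NT matrix_transpose_mul)
  have LX: "?L ** (N - ?J) = mat 1 - ?J"
    using N(2) by (simp add: shifted_def matrix_add_rdistrib matrix_diff_ldistrib laplacian_averaging JN
        eq_diff_eq)
  have XL: "(N - ?J) ** ?L = mat 1 - ?J"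
    using N(3) by (simp add: shifted_def matrix_add_ldistrib matrix_diff_rdistrib JL NJ eq_diff_eq)
  have "transpose (mat 1 - ?J) = mat 1 - ?J"
    using J by (simp add: transpose_def vec_eq_iff mat_def)
  then show "is_pseudoinverse ?L (N - ?J)"
    unfolding is_pseudoinverse_def LX XL
    by (simp add: matrix_diff_rdistrib matrix_diff_ldistrib JL JN averaging_matrix_idem)
qed

end

section \<open>The relaxed problem\<close>

lemma convex_feasible_relaxed_problem:
  fixes B :: "real^'m^'n"
  assumes "convex F"
  shows "convex (feasible (relaxed_problem B \<omega> f F \<gamma> \<alpha>))"
proof (rule convexI)
  fix p q :: "(real^'m) \<times> (real^'n^'n)" and s t :: real
  assume p: "p \<in> feasible (relaxed_problem B \<omega> f F \<gamma> \<alpha>)"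
    and q: "q \<in> feasible (relaxed_problem B \<omega> f F \<gamma> \<alpha>)"
    and st: "0 \<le> s" "0 \<le> t" "s + t = 1"
  obtain w K w' K' where pq: "p = (w, K)" "q = (w', K')"
    by (metis surj_pair)
  define W where "W = s *\<^sub>R w + t *\<^sub>R w'"
  define N where "N = s *\<^sub>R K + t *\<^sub>R K'"
  define Q where "Q = (\<lambda>v M x y. x \<bullet> ((laplacian B v + averaging_matrix) *v x) + 2 * (x \<bullet> y) + y \<bullet> (M *v y))"
  have sym: "laplacian B v + averaging_matrix \<in> symmetric_matrices" for v
    by (simp add: symmetric_matrices_add laplacian_symmetric averaging_matrix_symmetric)
  \<comment> \<open>The upper left block is always symmetric, so the matrix inequality amounts to
    symmetry of \<open>M\<close> and nonnegativity of \<open>Q\<close>.\<close>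
  have P: "(v, M) \<in> feasible (relaxed_problem B \<omega> f F \<gamma> \<alpha>) \<longleftrightarrow>
    v \<in> F \<and> M \<in> symmetric_matrices \<and> (\<forall>x y. 0 \<le> Q v M x y) \<and> infnorm (transpose B *v (M *v \<omega>)) \<le> sin \<gamma>" for v M
    by (auto simp: feasible_def relaxed_problem_def psd_block_matrix_iff sym Q_def)
  have "W \<in> F"
    using p q st assms by (simp add: pq P W_def convexD)
  moreover have "N \<in> symmetric_matrices"
    using p q by (simp add: pq P N_def symmetric_matrices_add symmetric_matrices_scaleR)
  moreover have "0 \<le> Q W N x y" for x y
  proof -
    \<comment> \<open>\<open>Q\<close> is affine rather than linear in \<open>(v, M)\<close>: the
      averaging term and the cross term are constant in it. The last summand corrects for this and
      vanishes because \<open>s + t = 1\<close>.\<close>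
    have "Q W N x y = s * Q w K x y + t * Q w' K' x y
        + (1 - (s + t)) * (x \<bullet> (averaging_matrix *v x) + 2 * (x \<bullet> y))"
      by (simp add: Q_def W_def N_def laplacian_add laplacian_scaleR matrix_vector_mult_add_rdistrib
          inner_add_right algebra_simps flip: scaleR_matrix_vector_assoc)
    also have "\<dots> \<ge> 0"
      using p q st by (simp add: pq P)
    finally show ?thesis .
  qed
  moreover have "infnorm (transpose B *v (N *v \<omega>)) \<le> sin \<gamma>"
  proof -
    let ?h = "\<lambda>M. transpose B *v (M *v \<omega>)"
    have "?h N = s *\<^sub>R ?h K + t *\<^sub>R ?h K'"
      by (simp add: N_def matrix_vector_mult_add_rdistrib matrix_vector_right_distrib
          matrix_vector_mult_scaleR flip: scaleR_matrix_vector_assoc)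
    then have "infnorm (?h N) \<le> s * infnorm (?h K) + t * infnorm (?h K')"
      using infnorm_triangle[of "s *\<^sub>R ?h K" "t *\<^sub>R ?h K'"] st by (simp add: infnorm_mul)
    also have "\<dots> \<le> s * sin \<gamma> + t * sin \<gamma>"
      using p q st by (intro add_mono mult_left_mono) (auto simp: pq P)
    also have "\<dots> = sin \<gamma>"
      using st by (simp flip: distrib_right)
    finally show ?thesis .
  qed
  ultimately show "s *\<^sub>R p + t *\<^sub>R q \<in> feasible (relaxed_problem B \<omega> f F \<gamma> \<alpha>)"
    by (simp add: pq P flip: W_def N_def)
qed

text \<open>The trace is linear, so adding its multiple to \<open>f\<close> preserves
  convexity.\<close>

lemma convex_problem_relaxed_problem:
  fixes B :: "real^'m^'n"
  assumes "convex_on F f"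
  shows "convex_problem (relaxed_problem B \<omega> f F \<gamma> \<alpha>)"
proof -
  have F: "convex F"
    using assms by (rule convex_on_imp_convex)
  have tr: "trace (s *\<^sub>R K + t *\<^sub>R K') = s * trace K + t * trace K'" for s t and K K' :: "real^'n^'n"
    by (simp add: trace_def sum.distrib sum_distrib_left)
  have "convex_on (F \<times> symmetric_matrices) (\<lambda>(w, K :: real^'n^'n). f w + \<alpha> * trace K)"
    unfolding convex_on_def
  proof (intro conjI ballI allI impI)
    show "convex (F \<times> (symmetric_matrices :: (real^'n^'n) set))"
      by (intro convex_Times F convex_symmetric_matrices)
  next
    fix p q :: "(real^'m) \<times> (real^'n^'n)" and s t :: real
    assume "p \<in> F \<times> symmetric_matrices" "q \<in> F \<times> symmetric_matrices" "0 \<le> s" "0 \<le> t" "s + t = 1"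
    moreover obtain w K w' K' where pq: "p = (w, K)" "q = (w', K')"
      by (metis surj_pair)
    ultimately have "f (s *\<^sub>R w + t *\<^sub>R w') \<le> s * f w + t * f w'"
      using assms by (auto simp: convex_on_def)
    then show "(case s *\<^sub>R p + t *\<^sub>R q of (w, K) \<Rightarrow> f w + \<alpha> * trace K)
      \<le> s * (case p of (w, K) \<Rightarrow> f w + \<alpha> * trace K) + t * (case q of (w, K) \<Rightarrow> f w + \<alpha> * trace K)"
      by (simp add: pq tr algebra_simps)
  qed
  then show ?thesis
    using convex_feasible_relaxed_problem[OF F]
    by (simp add: convex_problem_def relaxed_problem_def)
qed

lemma relaxed_problem_outer_approximation:
  fixes B :: "real^'m^'n"
  assumes B: "incidence_matrix E B" and F: "F \<subseteq> nonneg_orthant"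
    and pos: "\<And>w. w \<in> F \<Longrightarrow> 0 < lambda2 (laplacian B w)"
  shows "outer_approximation (relaxed_problem B \<omega> f F \<gamma> \<alpha>) (weight_design_problem B \<omega> f F \<gamma>)"
  unfolding outer_approximation_def
proof
  fix w
  assume "w \<in> feasible (weight_design_problem B \<omega> f F \<gamma>)"
  then have w: "w \<in> F" "infnorm (transpose B *v (pseudoinverse (laplacian B w) *v \<omega>)) \<le> sin \<gamma>"
    by (auto simp: feasible_def weight_design_problem_def)
  interpret weighted_laplacian E B w
    using B F pos w(1) by unfold_locales auto
  obtain N where N: "N \<in> symmetric_matrices" "shifted ** N = mat 1" "N ** shifted = mat 1"
    using shifted_inverse by blast
  \<comment> \<open>Averaging yields a constant vector, which \<open>transpose B\<close>
    annihilates; replacing the pseudoinverse by \<open>N\<close> therefore leaves the norm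
    constraint unchanged.\<close>
  have "transpose B *v (averaging_matrix *v \<omega>) = 0"
    unfolding averaging_matrix_vector by (rule incidence_matrix_transpose_const[OF B])
  then have "transpose B *v (pseudoinverse (laplacian B w) *v \<omega>) = transpose B *v (N *v \<omega>)"
    unfolding pseudoinverse_laplacian[OF N] matrix_vector_mult_diff_rdistrib matrix_vector_mult_diff_distrib
    by simp
  moreover have "psd (block_matrix shifted (mat 1) (mat 1) N)"
    by (rule psd_block_matrix_inverse[OF psd_shifted N(1,2)])
  ultimately have "(w, N) \<in> feasible (relaxed_problem B \<omega> f F \<gamma> \<alpha>)"
    using w N by (simp add: feasible_def relaxed_problem_def flip: shifted_def)
  then show "w \<in> fst ` feasible (relaxed_problem B \<omega> f F \<gamma> \<alpha>)"
    by force
qed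

theorem corollary4p3:
  fixes E :: "'n::finite set set"
    and B :: "real^'m^'n"
    and \<omega> :: "real^'n"
    and f :: "real^'m \<Rightarrow> real"
    and F :: "(real^'m) set"
    and \<gamma> \<alpha> :: real
  assumes "simple_graph E" and "connected_graph E" and "incidence_matrix E B"
    and "convex_on nonneg_orthant f"
    and "F \<subseteq> nonneg_orthant" and "closed F" and "convex F"
    and "\<And>w. w \<in> F \<Longrightarrow> 0 < lambda2 (laplacian B w)"
    and "0 \<le> \<gamma>" and "\<gamma> < pi / 2"
    and "0 < \<alpha>"
  shows "convex_problem (relaxed_problem B \<omega> f F \<gamma> \<alpha>) \<and>
         outer_approximation (relaxed_problem B \<omega> f F \<gamma> \<alpha>) (weight_design_problem B \<omega> f F \<gamma>)"
proof
  have "convex_on F f"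
    using assms(4,5,7) by (rule convex_on_subset)
  then show "convex_problem (relaxed_problem B \<omega> f F \<gamma> \<alpha>)"
    by (rule convex_problem_relaxed_problem)
  show "outer_approximation (relaxed_problem B \<omega> f F \<gamma> \<alpha>) (weight_design_problem B \<omega> f F \<gamma>)"
    using assms(3,5,8) by (rule relaxed_problem_outer_approximation)
qed

end
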